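(* Let $a>0$ and let $\Omega_a=\{(x_1,x_2,0): -a<x_1<a\}$ be a strip of the $(x_1,x_2)$-plane. Given constants $\kappa<0$ and $\beta\in\mathbb{R}$, there exists a stationary band $S=\{(r,x_2,u(r)): -a<r<a,\ x_2\in\mathbb{R}\}$ on $\Omega_a$, with mean curvature satisfying $2H=\kappa x_3$, whose directrix is defined by a function $u=u(\cdot;u_0)$ for some $u_0\in\mathbb{R}$, and that makes a contact hyperbolic angle $\beta$ with the support plane $\{x_3=u(a)\}$ along its boundary.
   Context: $\mathbb{L}^3$ is $\mathbb{R}^3$ with the Lorentzian metric $dx_1^2+dx_2^2-dx_3^2$. For a surface $S=\{(r,x_2,u(r))\}$ that is spacelike (i.e. $|u'|<1$), oriented by the unit normal $N$ in the same time-orientation as $(0,0,1)$, the mean curvature $H$ satisfies $2H=\dfrac{u''}{(1-u'^2)^{3/2}}$; thus the condition $2H=\kappa x_3$ on $S$ reads $\dfrac{u''(r)}{(1-u'(r)^2)^{3/2}}=\kappa u(r)$ for $-a<r<a$. Such a surface is called a stationary band on $\Omega_a$ (with capillary constant $\kappa$). The condition that $S$ makes contact hyperbolic angle $\beta$ with the plane $\{x_3=u(a)\}$ along its boundary reads $u'(\pm a)=\pm\tanh\beta$. For $u_0\in\mathbb{R}$, $u(\cdot;u_0)$ denotes the unique solution, defined on all of $\mathbb{R}$, of $\dfrac{u''}{(1-u'^2)^{3/2}}=\kappa u$ with $u(0)=u_0$, $u'(0)=0$, $|u'|<1$. *)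

theory Defs
  imports "HOL-Analysis.Analysis"
begin

definition lorentz :: "real^3 \<Rightarrow> real^3 \<Rightarrow> real" where
  "lorentz v w = v $ 1 * w $ 1 + v $ 2 * w $ 2 - v $ 3 * w $ 3"

definition e3 :: "real^3" where
  "e3 = vector [0, 0, 1]"


text \<open>Parametrized surfaces in Lorentz--Minkowski 3-space\<close>

type_synonym patch = "real \<times> real \<Rightarrow> real^3"

definition d1 :: "patch \<Rightarrow> patch" where
  "d1 X = (\<lambda>(s, t). vector_derivative (\<lambda>s'. X (s', t)) (at s))"

definition d2 :: "patch \<Rightarrow> patch" where
  "d2 X = (\<lambda>(s, t). vector_derivative (\<lambda>t'. X (s, t')) (at t))"

primrec Ck_patch :: "nat \<Rightarrow> patch \<Rightarrow> (real \<times> real) set \<Rightarrow> bool" where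
  "Ck_patch 0 X D \<longleftrightarrow> continuous_on D X"
| "Ck_patch (Suc k) X D \<longleftrightarrow>
     (\<forall>(s, t)\<in>D. (\<lambda>s'. X (s', t)) differentiable (at s) \<and> (\<lambda>t'. X (s, t')) differentiable (at t)) \<and>
     Ck_patch k (d1 X) D \<and> Ck_patch k (d2 X) D"

definition spacelike_at :: "patch \<Rightarrow> real \<times> real \<Rightarrow> bool" where
  "spacelike_at X p \<longleftrightarrow>
     (\<forall>s t. (s, t) \<noteq> (0, 0) \<longrightarrow>
       (let v = s *\<^sub>R d1 X p + t *\<^sub>R d2 X p in lorentz v v > 0))"

text \<open>
  The orientation of a spacelike surface: the timelike unit normal in the same time-orientation
  as \<open>e3\<close>, that is, with negative Lorentz product with \<open>e3\<close>.
\<close>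

definition unit_normal :: "patch \<Rightarrow> real \<times> real \<Rightarrow> real^3" where
  "unit_normal X p = (THE N. lorentz N (d1 X p) = 0 \<and> lorentz N (d2 X p) = 0 \<and>
                             lorentz N N = -1 \<and> lorentz N e3 < 0)"

text \<open>
  The mean curvature \<open>H\<close> is the coefficient of the mean curvature vector,
  \<open>H *\<^sub>R N = (trace of the vector-valued second fundamental form) / 2\<close>.
  The minus sign appears because the unit normal is timelike: the normal component of a vector
  \<open>w\<close> is \<open>- lorentz w N *\<^sub>R N\<close>.  For a graph \<open>(r, t, u r)\<close> this gives
  \<open>2 H = u'' / (1 - u'\<^sup>2) powr (3/2)\<close>, see lemma \<open>mean_curvature_band\<close> below.
\<close>

definition mean_curvature :: "patch \<Rightarrow> real \<times> real \<Rightarrow> real" where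
  "mean_curvature X p =
    (let N = unit_normal X p;
         E = lorentz (d1 X p) (d1 X p);
         F = lorentz (d1 X p) (d2 X p);
         G = lorentz (d2 X p) (d2 X p);
         e = - lorentz (d1 (d1 X) p) N;
         f = - lorentz (d1 (d2 X) p) N;
         g = - lorentz (d2 (d2 X) p) N
     in (e * G - 2 * f * F + g * E) / (2 * (E * G - F\<^sup>2)))"

definition stationary_patch :: "real \<Rightarrow> patch \<Rightarrow> (real \<times> real) set \<Rightarrow> bool" where
  "stationary_patch \<kappa> X D \<longleftrightarrow>
     Ck_patch 2 X D \<and> (\<forall>p\<in>D. spacelike_at X p \<and> 2 * mean_curvature X p = \<kappa> * X p $ 3)"


text \<open>Bands over a strip\<close>

text \<open>The plane \<open>x\<^sub>3 = 0\<close> is identified with \<open>real \<times> real\<close>.\<close>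

definition strip :: "real \<Rightarrow> (real \<times> real) set" where
  "strip a = {(x1, x2). -a < x1 \<and> x1 < a}"

definition band_patch :: "(real \<Rightarrow> real) \<Rightarrow> patch" where
  "band_patch u = (\<lambda>(r, x2). vector [r, x2, u r])"

definition stationary_band :: "real \<Rightarrow> real \<Rightarrow> (real \<Rightarrow> real) \<Rightarrow> (real^3) set \<Rightarrow> bool" where
  "stationary_band \<kappa> a u S \<longleftrightarrow>
     S = {vector [r, x2, u r] | r x2. -a < r \<and> r < a} \<and>
     stationary_patch \<kappa> (band_patch u) (strip a)"

text \<open>
  The boundary lies in the support plane \<open>{x\<^sub>3 = u a}\<close>, whose unit normal is \<open>e3\<close>, and
  \<open>\<beta>\<close> is the hyperbolic angle between the two unit normals along the boundary.  Since
  \<open>cosh\<close> is even, this determines \<open>\<beta>\<close> up to sign only; the sign is fixed by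
  \<open>u' (\<plusminus>a) = \<plusminus>tanh \<beta>\<close>.
\<close>

definition band_contact_angle :: "real \<Rightarrow> (real \<Rightarrow> real) \<Rightarrow> real \<Rightarrow> bool" where
  "band_contact_angle a u \<beta> \<longleftrightarrow>
     (\<forall>p \<in> {-a, a} \<times> UNIV. band_patch u p $ 3 = u a \<and>
        lorentz (unit_normal (band_patch u) p) e3 = - cosh \<beta>) \<and>
     u differentiable (at a) \<and> deriv u a = tanh \<beta> \<and>
     u differentiable (at (-a)) \<and> deriv u (-a) = - tanh \<beta>"

definition solves_band_ivp :: "real \<Rightarrow> real \<Rightarrow> (real \<Rightarrow> real) \<Rightarrow> bool" where
  "solves_band_ivp \<kappa> u0 u \<longleftrightarrow>
     (\<forall>r. u differentiable (at r) \<and> deriv u differentiable (at r) \<and> \<bar>deriv u r\<bar> < 1 \<and>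
          deriv (deriv u) r / (1 - (deriv u r)\<^sup>2) powr (3/2) = \<kappa> * u r) \<and>
     u 0 = u0 \<and> deriv u 0 = 0"

text \<open>\<open>u\<close> is the function written \<open>u(\<cdot>; u0)\<close>.\<close>

definition is_band_solution :: "real \<Rightarrow> real \<Rightarrow> (real \<Rightarrow> real) \<Rightarrow> bool" where
  "is_band_solution \<kappa> u0 u \<longleftrightarrow>
     solves_band_ivp \<kappa> u0 u \<and> (\<forall>v. solves_band_ivp \<kappa> u0 v \<longrightarrow> v = u)"


lemma vector3_has_vector_derivative:
  assumes "(f has_real_derivative f') (at x)" "(g has_real_derivative g') (at x)"
    "(h has_real_derivative h') (at x)"
  shows "((\<lambda>x. vector [f x, g x, h x] :: real^3) has_vector_derivative vector [f', g', h']) (at x)"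
proof -
  have eq: "vector [a, b, c] = a *\<^sub>R axis 1 1 + b *\<^sub>R axis 2 1 + c *\<^sub>R (axis 3 1 :: real^3)" for a b c
    by (simp add: vec_eq_iff forall_3 axis_def)
  show ?thesis
    unfolding eq using assms
    by (auto intro!: derivative_eq_intros)
qed

lemma unit_normal_band:
  assumes "(u has_real_derivative q) (at r)" "\<bar>q\<bar> < 1"
  shows "unit_normal (band_patch u) (r, t) = vector [q / sqrt (1 - q\<^sup>2), 0, 1 / sqrt (1 - q\<^sup>2)]"
proof -
  have d1: "d1 (band_patch u) (r, t) = vector [1, 0, q]"
    unfolding d1_def band_patch_def prod.case
    by (intro vector_derivative_at vector3_has_vector_derivative assms) auto
  have d2: "d2 (band_patch u) (r, t) = vector [0, 1, 0]"
    unfolding d2_def band_patch_def prod.case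
    by (intro vector_derivative_at vector3_has_vector_derivative) auto
  have pos: "1 - q\<^sup>2 > 0" using assms(2) by (simp add: abs_square_less_1)
  show ?thesis
    unfolding unit_normal_def d1 d2
  proof (rule the_equality, goal_cases)
    case 1
    have "q * q / (1 - q\<^sup>2) - 1 / (1 - q\<^sup>2) = - ((1 - q\<^sup>2) / (1 - q\<^sup>2))"
      by (simp only: diff_divide_distrib power2_eq_square)
    also have "\<dots> = -1" using pos by simp
    finally have "q * q / (1 - q\<^sup>2) - 1 / (1 - q\<^sup>2) = -1" .
    then show ?case using pos by (simp add: lorentz_def e3_def)
  next
    case (2 N)
    then have N: "N $ 1 = q * N $ 3" "N $ 2 = 0" "N $ 3 > 0"
      and "(q * N $ 3)\<^sup>2 - (N $ 3)\<^sup>2 = -1"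
      by (auto simp: lorentz_def e3_def power2_eq_square mult.commute)
    then have "(N $ 3)\<^sup>2 = 1 / (1 - q\<^sup>2)"
      using pos by (simp add: field_simps power2_eq_square)
    then have "N $ 3 = 1 / sqrt (1 - q\<^sup>2)"
      using N(3) by (metis less_imp_le real_sqrt_divide real_sqrt_one real_sqrt_unique)
    then show ?case using N by (simp add: vec_eq_iff forall_3)
  qed
qed

lemma mean_curvature_band:
  assumes u: "\<And>r. (u has_real_derivative u' r) (at r)" and u': "(u' has_real_derivative q) (at r)"
    and "\<bar>u' r\<bar> < 1"
  shows "2 * mean_curvature (band_patch u) (r, t) = q / (1 - (u' r)\<^sup>2) powr (3/2)"
proof -
  have d1: "d1 (band_patch u) = (\<lambda>(r, t). vector [1, 0, u' r])"
    unfolding d1_def band_patch_def prod.case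
    by (intro ext) (auto intro!: vector_derivative_at vector3_has_vector_derivative u)
  have d2: "d2 (band_patch u) = (\<lambda>_. vector [0, 1, 0])"
    unfolding d2_def band_patch_def prod.case
    by (intro ext) (auto intro!: vector_derivative_at vector3_has_vector_derivative)
  have d11: "d1 (d1 (band_patch u)) (r, t) = vector [0, 0, q]"
    unfolding d1 unfolding d1_def prod.case
    by (intro vector_derivative_at vector3_has_vector_derivative u') auto
  have d12: "d1 (d2 (band_patch u)) (r, t) = 0" and d22: "d2 (d2 (band_patch u)) (r, t) = 0"
    unfolding d2 by (auto simp: d1_def d2_def)
  have pos: "1 - (u' r)\<^sup>2 > 0" using assms(3) by (simp add: abs_square_less_1)
  have "(1 - (u' r)\<^sup>2) powr (3/2) = (1 - (u' r)\<^sup>2) powr (1 + 1/2)" by simp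
  also have "\<dots> = (1 - (u' r)\<^sup>2) * sqrt (1 - (u' r)\<^sup>2)"
    using pos by (subst powr_add) (simp add: powr_half_sqrt)
  finally have "(1 - (u' r)\<^sup>2) powr (3/2) = (1 - (u' r)\<^sup>2) * sqrt (1 - (u' r)\<^sup>2)" .
  moreover have "mean_curvature (band_patch u) (r, t) =
      (q / sqrt (1 - (u' r)\<^sup>2)) / (2 * (1 - (u' r)\<^sup>2))"
    unfolding mean_curvature_def Let_def unit_normal_band[OF u assms(3)] d11 d12 d22
    by (simp add: d1 d2 lorentz_def power2_eq_square)
  moreover have "2 * ((q / s) / (2 * w)) = q / (w * s)" for s w :: real
    by simp
  ultimately show ?thesis by (simp only:)
qed

end

theory Submission
  imports Defs
begin

text \<open>
  With \<open>w = u' / sqrt (1 - u'\<^sup>2)\<close> in place of \<open>u'\<close>, the equation becomes the system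
  \<open>u' = w / sqrt (1 + w\<^sup>2)\<close>, \<open>w' = \<kappa> u\<close>: a relativistic particle with momentum \<open>w\<close>, pulled towards
  the origin by a linear force since \<open>\<kappa> < 0\<close>. The right-hand side is globally Lipschitz, the
  constraint \<open>\<bar>u'\<bar> < 1\<close> has disappeared, and the contact condition at \<open>a\<close> reads \<open>w a = sinh \<beta>\<close>; the
  condition at \<open>-a\<close> follows because \<open>u\<close> is even. The angle is reached by shooting in the
  height \<open>u0 = u 0\<close>, with \<open>w 0 = 0\<close>.

  A Gronwall estimate (\<open>band_system_distance_bound\<close>) bounds the distance of two solutions by that
  of their initial values, up to an exponential factor. It gives uniqueness, evenness by comparison with the reflected solution,
  and continuity of \<open>w a\<close> in \<open>u0\<close>. Solutions on the whole line come from an explicit quadrature in an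
  angle that parametrizes the energy level (\<open>band_system_exists\<close>).

  Finally \<open>\<bar>u'\<bar> < 1\<close> keeps \<open>u\<close> within distance \<open>a\<close> of \<open>u0\<close> on \<open>{0..a}\<close>, so \<open>w a\<close> differs from
  \<open>\<kappa> u0 a\<close> by at most \<open>\<bar>\<kappa>\<bar> a\<^sup>2\<close> (\<open>band_system_momentum_estimate\<close>). As \<open>u0\<close> runs through the reals,
  \<open>w a\<close> is therefore unbounded in both directions, and by the intermediate value theorem it takes the
  value \<open>sinh \<beta>\<close>.
\<close>

section \<open>The equation as a first-order system\<close>

text \<open>
  The names are those of relativistic mechanics with unit mass and unit speed of light; the two maps
  are inverse bijections between the real line and \<open>{-1<..<1}\<close>, exchanging \<open>sinh x\<close> and \<open>tanh x\<close>.
\<close>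

definition velocity :: "real \<Rightarrow> real" where
  "velocity p = p / sqrt (1 + p\<^sup>2)"

definition momentum :: "real \<Rightarrow> real" where
  "momentum q = q / sqrt (1 - q\<^sup>2)"

definition band_system :: "real \<Rightarrow> (real \<Rightarrow> real) \<Rightarrow> (real \<Rightarrow> real) \<Rightarrow> bool" where
  "band_system \<kappa> u w \<longleftrightarrow>
     (\<forall>r. (u has_real_derivative velocity (w r)) (at r) \<and> (w has_real_derivative \<kappa> * u r) (at r))"

lemma powr_three_halves:
  fixes x :: real
  assumes "x \<ge> 0"
  shows "x powr (3/2) = x * sqrt x"
proof (cases "x = 0")
  case False
  have "x powr (3/2) = x powr (1 + 1/2)" by simp
  also have "\<dots> = x * sqrt x"
    using assms False by (subst powr_add) (simp add: powr_half_sqrt)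
  finally show ?thesis .
qed simp

lemma one_plus_square_pos: "1 + (p::real)\<^sup>2 > 0"
  by (simp add: add_pos_nonneg)

lemma one_minus_velocity_square: "1 - (velocity p)\<^sup>2 = 1 / (1 + p\<^sup>2)"
proof -
  have "(velocity p)\<^sup>2 = p\<^sup>2 / (1 + p\<^sup>2)"
    by (simp add: velocity_def power_divide)
  then show ?thesis
    using one_plus_square_pos[of p] by (simp add: field_simps)
qed

lemma abs_velocity_less_1: "\<bar>velocity p\<bar> < 1"
proof -
  have "1 - (velocity p)\<^sup>2 > 0"
    using one_plus_square_pos[of p] by (simp add: one_minus_velocity_square)
  then show ?thesis by (simp flip: abs_square_less_1)
qed

lemma velocity_momentum:
  assumes "\<bar>q\<bar> < 1"
  shows "velocity (momentum q) = q"
proof -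
  have pos: "1 - q\<^sup>2 > 0" using assms by (simp add: abs_square_less_1)
  have "(momentum q)\<^sup>2 = q\<^sup>2 / (1 - q\<^sup>2)"
    using pos by (simp add: momentum_def power_divide)
  then have "1 + (momentum q)\<^sup>2 = 1 / (1 - q\<^sup>2)"
    using pos by (simp add: field_simps)
  then show ?thesis
    using pos by (simp add: velocity_def momentum_def real_sqrt_divide)
qed

lemma velocity_sinh: "velocity (sinh x) = tanh x"
proof -
  have "sqrt (1 + (sinh x)\<^sup>2) = cosh x"
    by (rule real_sqrt_unique) (auto simp: cosh_square_eq)
  then show ?thesis by (simp add: velocity_def tanh_def)
qed

lemma velocity_uminus: "velocity (- p) = - velocity p"
  by (simp add: velocity_def)

lemma velocity_has_derivative:
  "(velocity has_real_derivative 1 / (1 + p\<^sup>2) powr (3/2)) (at p)"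
proof -
  have pos: "1 + p\<^sup>2 > 0" by (rule one_plus_square_pos)
  have sq: "sqrt (1 + p\<^sup>2) * sqrt (1 + p\<^sup>2) = 1 + p\<^sup>2" using pos by simp
  have "((\<lambda>p. p / sqrt (1 + p\<^sup>2)) has_real_derivative
      (1 * sqrt (1 + p\<^sup>2) - p * (p / sqrt (1 + p\<^sup>2))) / (sqrt (1 + p\<^sup>2) * sqrt (1 + p\<^sup>2))) (at p)"
    using pos by (auto intro!: derivative_eq_intros simp: field_simps)
  also have "(1 * sqrt (1 + p\<^sup>2) - p * (p / sqrt (1 + p\<^sup>2))) / (sqrt (1 + p\<^sup>2) * sqrt (1 + p\<^sup>2))
      = 1 / (1 + p\<^sup>2) powr (3/2)"
    unfolding sq using pos sq
    by (simp add: powr_three_halves field_simps power2_eq_square)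
  finally show ?thesis unfolding velocity_def .
qed

lemma momentum_has_derivative:
  assumes "\<bar>q\<bar> < 1"
  shows "(momentum has_real_derivative 1 / (1 - q\<^sup>2) powr (3/2)) (at q)"
proof -
  have pos: "1 - q\<^sup>2 > 0" using assms by (simp add: abs_square_less_1)
  have sq: "sqrt (1 - q\<^sup>2) * sqrt (1 - q\<^sup>2) = 1 - q\<^sup>2" using pos by simp
  have "((\<lambda>q. q / sqrt (1 - q\<^sup>2)) has_real_derivative
      (1 * sqrt (1 - q\<^sup>2) - q * (- q / sqrt (1 - q\<^sup>2))) / (sqrt (1 - q\<^sup>2) * sqrt (1 - q\<^sup>2))) (at q)"
    using pos by (auto intro!: derivative_eq_intros simp: field_simps)
  also have "(1 * sqrt (1 - q\<^sup>2) - q * (- q / sqrt (1 - q\<^sup>2))) / (sqrt (1 - q\<^sup>2) * sqrt (1 - q\<^sup>2))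
      = 1 / (1 - q\<^sup>2) powr (3/2)"
    unfolding sq using pos sq
    by (simp add: powr_three_halves field_simps power2_eq_square)
  finally show ?thesis unfolding momentum_def .
qed

lemma velocity_lipschitz: "\<bar>velocity p - velocity q\<bar> \<le> \<bar>p - q\<bar>"
proof -
  have "norm (velocity p - velocity q) \<le> 1 * norm (p - q)"
  proof (rule field_differentiable_bound[where S=UNIV and f'="\<lambda>p. 1 / (1 + p\<^sup>2) powr (3/2)"])
    show "norm (1 / (1 + x\<^sup>2) powr (3/2)) \<le> 1" for x :: real
      using ge_one_powr_ge_zero[of "1 + x\<^sup>2" "3/2"] by (simp add: divide_le_eq_1)
  qed (auto intro: velocity_has_derivative)
  then show ?thesis by simp
qed

text \<open>
  The derivative of \<^const>\<open>momentum\<close> is the factor \<open>(1 - q\<^sup>2) powr (-3/2)\<close> of the curvature equation, so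
  that equation says that the momentum of \<open>u'\<close> has derivative \<open>\<kappa> u\<close>. Conversely, a velocity is always
  less than 1 in modulus, so every solution of the system is spacelike.
\<close>

lemma solves_band_ivp_iff_system:
  "solves_band_ivp \<kappa> u0 u \<longleftrightarrow> (\<exists>w. band_system \<kappa> u w \<and> u 0 = u0 \<and> w 0 = 0)"
proof
  assume L: "solves_band_ivp \<kappa> u0 u"
  define w where "w r = momentum (deriv u r)" for r
  have bound: "\<bar>deriv u r\<bar> < 1" for r using L by (simp add: solves_band_ivp_def)
  have "(u has_real_derivative velocity (w r)) (at r)" for r
  proof -
    have "(u has_real_derivative deriv u r) (at r)"
      using L by (simp add: solves_band_ivp_def DERIV_deriv_iff_real_differentiable)
    then show ?thesis by (simp add: w_def velocity_momentum bound)
  qed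
  moreover have "(w has_real_derivative \<kappa> * u r) (at r)" for r
  proof -
    have "(deriv u has_real_derivative deriv (deriv u) r) (at r)"
      using L by (simp add: solves_band_ivp_def DERIV_deriv_iff_real_differentiable)
    from DERIV_chain2[OF momentum_has_derivative[OF bound] this]
    have "(w has_real_derivative deriv (deriv u) r / (1 - (deriv u r)\<^sup>2) powr (3/2)) (at r)"
      by (simp add: w_def[abs_def])
    then show ?thesis using L by (simp add: solves_band_ivp_def)
  qed
  ultimately show "\<exists>w. band_system \<kappa> u w \<and> u 0 = u0 \<and> w 0 = 0"
    using L by (intro exI[of _ w]) (simp add: band_system_def w_def momentum_def solves_band_ivp_def)
next
  assume "\<exists>w. band_system \<kappa> u w \<and> u 0 = u0 \<and> w 0 = 0"
  then obtain w where w: "band_system \<kappa> u w" and init: "u 0 = u0" "w 0 = 0" by blast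
  have u': "(u has_real_derivative velocity (w r)) (at r)" for r
    using w by (simp add: band_system_def)
  have deriv_u: "deriv u = (\<lambda>r. velocity (w r))"
    using u' by (intro ext DERIV_imp_deriv)
  have u'': "(deriv u has_real_derivative \<kappa> * u r / (1 + (w r)\<^sup>2) powr (3/2)) (at r)" for r
    using DERIV_chain2[OF velocity_has_derivative, of w "\<kappa> * u r" r] w
    by (simp add: deriv_u band_system_def)
  have "deriv (deriv u) r / (1 - (deriv u r)\<^sup>2) powr (3/2) = \<kappa> * u r" for r
    unfolding DERIV_imp_deriv[OF u''] using one_plus_square_pos[of "w r"]
    by (simp add: deriv_u one_minus_velocity_square powr_divide)
  moreover have "u differentiable at r" "deriv u differentiable at r" for r
    using u' u'' real_differentiable_def by blast+
  ultimately show "solves_band_ivp \<kappa> u0 u"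
    by (simp add: solves_band_ivp_def init deriv_u abs_velocity_less_1) (simp add: velocity_def init)
qed


section \<open>Uniqueness and continuous dependence\<close>

text \<open>
  The bound on \<open>f'\<close> makes \<open>f x * exp (- C * x)\<close> nonincreasing and \<open>f x * exp (C * x)\<close> nondecreasing; the first is
  used to the right of 0 and the second to the left.
\<close>

lemma gronwall_two_sided:
  fixes f f' :: "real \<Rightarrow> real"
  assumes der: "\<And>r. (f has_real_derivative f' r) (at r)"
    and bound: "\<And>r. \<bar>f' r\<bar> \<le> C * f r"
  shows "f r \<le> f 0 * exp (C * \<bar>r\<bar>)"
proof (cases "r \<ge> 0")
  case True
  have "f r * exp (- C * r) \<le> f 0 * exp (- C * 0)"
  proof (rule DERIV_nonpos_imp_nonincreasing[where f="\<lambda>x. f x * exp (- C * x)", OF True])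
    fix x
    have "((\<lambda>x. f x * exp (- C * x)) has_real_derivative (f' x - C * f x) * exp (- C * x)) (at x)"
      by (auto intro!: derivative_eq_intros der simp: algebra_simps)
    moreover have "(f' x - C * f x) * exp (- C * x) \<le> 0"
      using bound[of x] by (intro mult_nonpos_nonneg) auto
    ultimately show "\<exists>y. ((\<lambda>x. f x * exp (- C * x)) has_real_derivative y) (at x) \<and> y \<le> 0"
      by blast
  qed
  then show ?thesis using True by (simp add: exp_minus field_simps)
next
  case False
  have "f r * exp (C * r) \<le> f 0 * exp (C * 0)"
  proof (rule DERIV_nonneg_imp_nondecreasing[where f="\<lambda>x. f x * exp (C * x)"])
    show "r \<le> 0" using False by simp
    fix x
    have "((\<lambda>x. f x * exp (C * x)) has_real_derivative (f' x + C * f x) * exp (C * x)) (at x)"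
      by (auto intro!: derivative_eq_intros der simp: algebra_simps)
    moreover have "(f' x + C * f x) * exp (C * x) \<ge> 0"
      using bound[of x] by (intro mult_nonneg_nonneg) auto
    ultimately show "\<exists>y. ((\<lambda>x. f x * exp (C * x)) has_real_derivative y) (at x) \<and> y \<ge> 0"
      by blast
  qed
  then show ?thesis using False by (simp add: exp_minus field_simps)
qed

text \<open>
  Since \<^const>\<open>velocity\<close> is 1-Lipschitz, the derivative of the squared distance is at most
  \<open>(1 + \<bar>\<kappa>\<bar>) * 2 * \<bar>u - v\<bar> * \<bar>w - z\<bar>\<close>, which is at most \<open>1 + \<bar>\<kappa>\<bar>\<close> times the squared distance.
\<close>

lemma band_system_distance_bound:
  assumes "band_system \<kappa> u w" "band_system \<kappa> v z"
  shows "(u r - v r)\<^sup>2 + (w r - z r)\<^sup>2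
    \<le> ((u 0 - v 0)\<^sup>2 + (w 0 - z 0)\<^sup>2) * exp ((1 + \<bar>\<kappa>\<bar>) * \<bar>r\<bar>)"
proof (rule gronwall_two_sided)
  fix r
  show "((\<lambda>r. (u r - v r)\<^sup>2 + (w r - z r)\<^sup>2) has_real_derivative
     2 * (u r - v r) * (velocity (w r) - velocity (z r)) + 2 * (w r - z r) * (\<kappa> * (u r - v r))) (at r)"
    using assms unfolding band_system_def
    by (auto intro!: derivative_eq_intros simp: algebra_simps)
  have "\<bar>2 * (u r - v r) * (velocity (w r) - velocity (z r)) + 2 * (w r - z r) * (\<kappa> * (u r - v r))\<bar>
     \<le> 2 * \<bar>u r - v r\<bar> * \<bar>velocity (w r) - velocity (z r)\<bar> + 2 * \<bar>w r - z r\<bar> * (\<bar>\<kappa>\<bar> * \<bar>u r - v r\<bar>)"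
    by (rule order.trans[OF abs_triangle_ineq])
       (simp add: abs_mult del: right_diff_distrib_numeral)
  also have "\<dots> \<le> 2 * \<bar>u r - v r\<bar> * \<bar>w r - z r\<bar> + 2 * \<bar>w r - z r\<bar> * (\<bar>\<kappa>\<bar> * \<bar>u r - v r\<bar>)"
    by (intro add_mono mult_left_mono velocity_lipschitz) auto
  also have "\<dots> = (1 + \<bar>\<kappa>\<bar>) * (2 * \<bar>u r - v r\<bar> * \<bar>w r - z r\<bar>)"
    by (simp add: algebra_simps)
  also have "\<dots> \<le> (1 + \<bar>\<kappa>\<bar>) * ((u r - v r)\<^sup>2 + (w r - z r)\<^sup>2)"
    using sum_squares_bound[of "\<bar>u r - v r\<bar>" "\<bar>w r - z r\<bar>"] by (intro mult_left_mono) auto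
  finally show "\<bar>2 * (u r - v r) * (velocity (w r) - velocity (z r)) + 2 * (w r - z r) * (\<kappa> * (u r - v r))\<bar>
     \<le> (1 + \<bar>\<kappa>\<bar>) * ((u r - v r)\<^sup>2 + (w r - z r)\<^sup>2)" .
qed

lemma band_system_unique:
  assumes "band_system \<kappa> u w" "band_system \<kappa> v z" "u 0 = v 0" "w 0 = z 0"
  shows "u = v" "w = z"
proof -
  have "(u r - v r)\<^sup>2 + (w r - z r)\<^sup>2 \<le> 0" for r
    using band_system_distance_bound[OF assms(1,2), of r] assms(3,4) by simp
  then have "u r = v r \<and> w r = z r" for r
    by (metis right_minus_eq sum_power2_le_zero_iff)
  then show "u = v" "w = z" by auto
qed

text \<open>Time reversal: it keeps positions and reverses momenta.\<close>

lemma band_system_reflect: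
  assumes "band_system \<kappa> u w"
  shows "band_system \<kappa> (\<lambda>r. u (- r)) (\<lambda>r. - w (- r))"
proof -
  have "(u has_real_derivative velocity (w (- r))) (at (- r))"
       "(w has_real_derivative \<kappa> * u (- r)) (at (- r))" for r
    using assms by (auto simp: band_system_def)
  then have "((\<lambda>r. u (- r)) has_real_derivative - velocity (w (- r))) (at r)"
     "((\<lambda>r. w (- r)) has_real_derivative - (\<kappa> * u (- r))) (at r)" for r
    by (auto intro: DERIV_mirror[THEN iffD1])
  from this(1) DERIV_minus[OF this(2)] show ?thesis
    by (simp add: band_system_def velocity_uminus)
qed

lemma is_band_solutionI:
  assumes "band_system \<kappa> u w" "u 0 = u0" "w 0 = 0"
  shows "is_band_solution \<kappa> u0 u"
proof -
  have "v = u" if v: "solves_band_ivp \<kappa> u0 v" for v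
  proof -
    obtain z where "band_system \<kappa> v z" "v 0 = u0" "z 0 = 0"
      using v unfolding solves_band_ivp_iff_system by blast
    then show "v = u"
      using band_system_unique(1)[OF _ assms(1), of v z] assms(2,3) by simp
  qed
  moreover have "solves_band_ivp \<kappa> u0 u"
    unfolding solves_band_ivp_iff_system using assms by (intro exI[of _ w]) simp
  ultimately show ?thesis unfolding is_band_solution_def by blast
qed


section \<open>Global existence by quadrature\<close>

text \<open>
  Separation of variables: the solution is the inverse of an antiderivative \<open>R\<close> of \<open>1 / f\<close>. The upper
  bound on \<open>f\<close> prevents blow-up: it makes \<open>R\<close> grow at least with slope \<open>1 / M\<close>, so \<open>R\<close> is a
  bijection of the real line.
\<close>

lemma scalar_autonomous_global_solution:
  fixes f :: "real \<Rightarrow> real"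
  assumes cont: "continuous_on UNIV f" and pos: "\<And>x. f x > 0" and le: "\<And>x. f x \<le> M"
  shows "\<exists>\<theta>. \<theta> 0 = 0 \<and> (\<forall>r. (\<theta> has_real_derivative f (\<theta> r)) (at r))"
proof -
  have M: "M > 0" using pos[of 0] le[of 0] by simp
  have isc: "isCont (\<lambda>x. 1 / f x) x" for x
    using cont pos[of x] by (intro continuous_intros) (auto simp: continuous_on_eq_continuous_at)
  obtain G where G: "\<And>x. (G has_vector_derivative 1 / f x) (at x)"
    using einterval_antiderivative[of "-\<infinity>" \<infinity> "\<lambda>x. 1 / f x"] isc by auto
  define R where "R x = G x - G 0" for x
  have R': "(R has_real_derivative 1 / f x) (at x)" for x
    unfolding R_def using G[of x]
    by (auto intro!: derivative_eq_intros simp: has_real_derivative_iff_has_vector_derivative)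
  have R_cont: "continuous_on A R" for A
    using R' by (meson DERIV_isCont continuous_at_imp_continuous_on)
  have slope: "R y - R x \<ge> (y - x) / M" if "x \<le> y" for x y
  proof -
    have "R x - x / M \<le> R y - y / M"
    proof (rule DERIV_nonneg_imp_nondecreasing[OF that])
      fix t
      have "((\<lambda>t. R t - t / M) has_real_derivative 1 / f t - 1 / M) (at t)"
        using M by (auto intro!: derivative_eq_intros R')
      moreover have "1 / f t - 1 / M \<ge> 0"
        using pos[of t] le[of t] M by (simp add: frac_le)
      ultimately show "\<exists>d. ((\<lambda>t. R t - t / M) has_real_derivative d) (at t) \<and> 0 \<le> d" by blast
    qed
    then show ?thesis by (simp add: diff_divide_distrib)
  qed
  have inj: "inj R"
  proof (rule linorder_injI)
    fix x y :: real assume "x < y"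
    then have "(y - x) / M > 0" using M by simp
    then show "R x \<noteq> R y" using slope[of x y] \<open>x < y\<close> by auto
  qed
  have "\<exists>x. R x = r" for r
  proof -
    define h where "h = M * \<bar>r\<bar>"
    have "h \<ge> 0" using M by (simp add: h_def)
    moreover have "R 0 = 0" by (simp add: R_def)
    moreover have "h / M = \<bar>r\<bar>" using M by (simp add: h_def)
    ultimately have "R (- h) \<le> r" "r \<le> R h"
      using slope[of "-h" 0] slope[of 0 h] by auto
    then show ?thesis using IVT'[of R "-h" r h] R_cont \<open>h \<ge> 0\<close> by auto
  qed
  then have surj: "surj R" by (metis surjI)
  define \<theta> where "\<theta> = inv R"
  have R\<theta>: "R (\<theta> r) = r" and \<theta>R: "\<theta> (R x) = x" for r x
    using surj inj by (auto simp: \<theta>_def surj_f_inv_f)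
  have "\<bar>\<theta> y - \<theta> x\<bar> \<le> M * \<bar>y - x\<bar>" for x y
  proof -
    have "\<bar>\<theta> y - \<theta> x\<bar> / M \<le> \<bar>y - x\<bar>"
      using slope[of "\<theta> x" "\<theta> y"] slope[of "\<theta> y" "\<theta> x"]
      by (cases "\<theta> x \<le> \<theta> y") (auto simp: R\<theta> abs_if)
    then show ?thesis using M by (simp add: divide_le_eq mult.commute)
  qed
  then have "M-lipschitz_on UNIV \<theta>"
    using M by (intro lipschitz_onI) (auto simp: dist_real_def)
  then have "continuous_on UNIV \<theta>"
    by (rule lipschitz_on_continuous_on)
  then have \<theta>_cont: "isCont \<theta> r" for r
    by (simp add: continuous_on_eq_continuous_at)
  have "(\<theta> has_real_derivative inverse (1 / f (\<theta> r))) (at r)" for r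
    by (rule DERIV_inverse_function[where f=R and a="r - 1" and b="r + 1"])
       (use R' pos[of "\<theta> r"] in \<open>auto simp: R\<theta> \<theta>_cont\<close>)
  moreover have "\<theta> 0 = 0" using \<theta>R[of 0] by (simp add: R_def)
  ultimately show ?thesis by auto
qed

text \<open>
  The energy \<open>sqrt (1 + w\<^sup>2) - \<kappa> u\<^sup>2 / 2\<close> is conserved. Integrating \<open>u'\<close> directly along a level set of it
  breaks down at the turning points, where \<open>u'\<close> vanishes. Writing \<open>u = u0 cos \<theta>\<close> parametrizes the level
  set regularly: with \<open>c = sqrt (- \<kappa>)\<close>, \<open>b = c u0 / 2\<close> and \<open>s = b sin \<theta>\<close>, conservation of energy reads
  \<open>sqrt (1 + w\<^sup>2) = 1 + 2 s\<^sup>2\<close>, hence \<open>w = - 2 s sqrt (1 + s\<^sup>2)\<close>, and the system reduces to the scalar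
  equation \<open>\<theta>' = c sqrt (1 + s\<^sup>2) / (1 + 2 s\<^sup>2)\<close>, whose right-hand side lies in \<open>{0<..c}\<close>.
\<close>

lemma band_system_exists:
  assumes "\<kappa> < 0"
  shows "\<exists>u w. band_system \<kappa> u w \<and> u 0 = u0 \<and> w 0 = 0"
proof -
  define c where "c = sqrt (- \<kappa>)"
  have c: "c > 0" "c * c = - \<kappa>" using assms by (auto simp: c_def)
  define b where "b = c * u0 / 2"
  define Q where "Q t = sqrt (1 + (b * sin t)\<^sup>2)" for t
  define f where "f t = c * Q t / (1 + 2 * (b * sin t)\<^sup>2)" for t
  have Q_ge: "Q t \<ge> 1" for t by (simp add: Q_def)
  have Q_sq: "(Q t)\<^sup>2 = 1 + (b * sin t)\<^sup>2" for t by (simp add: Q_def)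
  have den: "1 + 2 * (b * sin t)\<^sup>2 > 0" for t by (simp add: add_pos_nonneg)
  have Q_le: "Q t \<le> 1 + 2 * (b * sin t)\<^sup>2" for t
  proof -
    have "Q t * 1 \<le> Q t * Q t" using Q_ge[of t] by (intro mult_left_mono) auto
    then show ?thesis using Q_sq[of t] zero_le_power2[of "b * sin t"]
      unfolding power2_eq_square[of "Q t"] by linarith
  qed
  obtain \<theta> where \<theta>0: "\<theta> 0 = 0" and \<theta>': "\<And>r. (\<theta> has_real_derivative f (\<theta> r)) (at r)"
  proof -
    have "continuous_on UNIV f"
      unfolding f_def Q_def using den by (intro continuous_intros) (metis less_irrefl)
    moreover have "f t > 0" for t
      unfolding f_def using c(1) den[of t] Q_ge[of t] by (intro divide_pos_pos mult_pos_pos) auto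
    moreover have "f t \<le> c" for t
      unfolding f_def using c(1) den[of t] Q_le[of t] by (simp add: divide_le_eq)
    ultimately show ?thesis using scalar_autonomous_global_solution that by blast
  qed
  define u where "u r = u0 * cos (\<theta> r)" for r
  define w where "w r = - 2 * (b * sin (\<theta> r)) * Q (\<theta> r)" for r
  have "(u has_real_derivative velocity (w r)) (at r)" for r
  proof -
    define s where "s = b * sin (\<theta> r)"
    have "1 + (w r)\<^sup>2 = (1 + 2 * s\<^sup>2)\<^sup>2"
      by (simp add: w_def Q_sq power_mult_distrib flip: s_def) (simp add: power2_eq_square algebra_simps)
    then have "sqrt (1 + (w r)\<^sup>2) = 1 + 2 * s\<^sup>2" by simp
    then have vel: "velocity (w r) = - 2 * s * Q (\<theta> r) / (1 + 2 * s\<^sup>2)"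
      by (simp add: velocity_def w_def s_def)
    have "(u has_real_derivative u0 * (- sin (\<theta> r) * f (\<theta> r))) (at r)"
      unfolding u_def by (auto intro!: derivative_eq_intros \<theta>')
    also have "u0 * (- sin (\<theta> r) * f (\<theta> r)) = velocity (w r)"
      unfolding vel f_def by (simp add: s_def b_def)
    finally show ?thesis .
  qed
  moreover have "(w has_real_derivative \<kappa> * u r) (at r)" for r
  proof -
    define s where "s = sin (\<theta> r)"
    define q where "q = Q (\<theta> r)"
    have q: "q > 0" "q * q = 1 + (b * s)\<^sup>2"
      using Q_ge[of "\<theta> r"] Q_sq[of "\<theta> r"] by (auto simp: q_def s_def power2_eq_square)
    have "(Q has_real_derivative b\<^sup>2 * s * cos (\<theta> r) / q) (at (\<theta> r))"
      unfolding Q_def q_def s_def using one_plus_square_pos[of "b * sin (\<theta> r)"]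
      by (auto intro!: derivative_eq_intros simp: field_simps power2_eq_square)
    from DERIV_chain2[OF this \<theta>']
    have "(w has_real_derivative
        - 2 * b * cos (\<theta> r) * f (\<theta> r) * q - 2 * b * s * (b\<^sup>2 * s * cos (\<theta> r) / q * f (\<theta> r))) (at r)"
      unfolding w_def q_def s_def
      by (auto intro!: derivative_eq_intros \<theta>')
    also have "- 2 * b * cos (\<theta> r) * f (\<theta> r) * q - 2 * b * s * (b\<^sup>2 * s * cos (\<theta> r) / q * f (\<theta> r))
        = - 2 * b * cos (\<theta> r) * f (\<theta> r) * ((q * q + (b * s)\<^sup>2) / q)"
      using q(1) by (simp add: field_simps power2_eq_square)
    also have "\<dots> = - 2 * b * cos (\<theta> r) * (f (\<theta> r) * ((1 + 2 * (b * s)\<^sup>2) / q))"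
      by (simp add: q(2))
    also have "f (\<theta> r) * ((1 + 2 * (b * s)\<^sup>2) / q) = c"
      using q(1) den[of "\<theta> r"] by (simp add: f_def q_def s_def)
    also have "- 2 * b * cos (\<theta> r) * c = \<kappa> * u r"
    proof -
      have "- 2 * b * cos (\<theta> r) * c = - (c * c) * (u0 * cos (\<theta> r))" by (simp add: b_def)
      then show ?thesis by (simp add: c(2) u_def)
    qed
    finally show ?thesis .
  qed
  ultimately show ?thesis
    by (intro exI[of _ u] exI[of _ w]) (simp add: band_system_def u_def w_def \<theta>0)
qed


section \<open>Shooting for the contact angle\<close>

text \<open>
  This is the growth needed for shooting: for \<open>\<kappa> \<noteq> 0\<close> and \<open>a > 0\<close> the term \<open>\<kappa> * u 0 * a\<close> dominates
  for large \<open>\<bar>u 0\<bar>\<close>, because the error does not depend on \<open>u 0\<close>.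
\<close>

lemma band_system_momentum_estimate:
  assumes "band_system \<kappa> u w" "w 0 = 0" "a \<ge> 0"
  shows "\<bar>w a - \<kappa> * u 0 * a\<bar> \<le> \<bar>\<kappa>\<bar> * a\<^sup>2"
proof -
  have u': "(u has_real_derivative velocity (w r)) (at r)"
    and w': "(w has_real_derivative \<kappa> * u r) (at r)" for r
    using assms(1) by (auto simp: band_system_def)
  have lip: "\<bar>u r - u 0\<bar> \<le> \<bar>r\<bar>" for r
    using field_differentiable_bound[of UNIV u "\<lambda>r. velocity (w r)" 1 r 0] u'
    by (auto intro: less_imp_le abs_velocity_less_1)
  have "norm ((w a - \<kappa> * u 0 * a) - (w 0 - \<kappa> * u 0 * 0)) \<le> (\<bar>\<kappa>\<bar> * a) * norm (a - 0)"
  proof (rule field_differentiable_bound[where S="{0..a}" and f'="\<lambda>r. \<kappa> * (u r - u 0)"])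
    fix r assume r: "r \<in> {0..a}"
    show "((\<lambda>r. w r - \<kappa> * u 0 * r) has_real_derivative \<kappa> * (u r - u 0)) (at r within {0..a})"
      by (rule has_field_derivative_at_within)
         (auto intro!: derivative_eq_intros w' simp: algebra_simps)
    show "norm (\<kappa> * (u r - u 0)) \<le> \<bar>\<kappa>\<bar> * a"
      using lip[of r] r by (auto simp: abs_mult intro!: mult_left_mono)
  qed (use assms(3) in auto)
  then show ?thesis using assms(2,3) by (simp add: power2_eq_square mult.assoc)
qed

lemma band_system_attains_momentum:
  assumes "\<kappa> < 0" "a > 0"
  shows "\<exists>u w. band_system \<kappa> u w \<and> w 0 = 0 \<and> w a = p"
proof -
  have "\<forall>x. \<exists>u w. band_system \<kappa> u w \<and> u 0 = x \<and> w 0 = 0"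
    using band_system_exists[OF assms(1)] by blast
  then obtain U W where UW: "\<And>x. band_system \<kappa> (U x) (W x)" "\<And>x. U x 0 = x" "\<And>x. W x 0 = 0"
    unfolding choice_iff by blast
  define K where "K = sqrt (exp ((1 + \<bar>\<kappa>\<bar>) * \<bar>a\<bar>))"
  have "\<bar>W x a - W y a\<bar> \<le> K * \<bar>x - y\<bar>" for x y
  proof -
    have "(W x a - W y a)\<^sup>2 \<le> (x - y)\<^sup>2 * exp ((1 + \<bar>\<kappa>\<bar>) * \<bar>a\<bar>)"
      using band_system_distance_bound[OF UW(1)[of x] UW(1)[of y], of a]
        zero_le_power2[of "U x a - U y a"]
      unfolding UW(2,3) diff_self power_zero_numeral add_0_right by linarith
    then have "sqrt ((W x a - W y a)\<^sup>2) \<le> sqrt ((x - y)\<^sup>2 * exp ((1 + \<bar>\<kappa>\<bar>) * \<bar>a\<bar>))"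
      by (rule real_sqrt_le_mono)
    then show ?thesis by (simp add: K_def real_sqrt_mult mult.commute)
  qed
  then have "K-lipschitz_on UNIV (\<lambda>x. W x a)"
    by (intro lipschitz_onI) (auto simp: dist_real_def K_def)
  then have cont: "continuous_on A (\<lambda>x. W x a)" for A
    by (meson continuous_on_subset lipschitz_on_continuous_on subset_UNIV)
  have bound: "\<bar>W x a - \<kappa> * x * a\<bar> \<le> \<bar>\<kappa>\<bar> * a\<^sup>2" for x
    using band_system_momentum_estimate[OF UW(1) UW(3), of a x] assms(2) by (simp add: UW(2))
  \<comment> \<open>Chosen so that \<open>\<kappa> * x * a\<close> overshoots \<open>p\<close> by exactly the error bound; as \<open>\<kappa> * a\<close> is negative,
    the larger height gives the smaller momentum.\<close>
  define lo hi where "lo = (p + \<bar>\<kappa>\<bar> * a\<^sup>2) / (\<kappa> * a)" and "hi = (p - \<bar>\<kappa>\<bar> * a\<^sup>2) / (\<kappa> * a)"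
  have \<kappa>a: "\<kappa> * a < 0" using assms by (simp add: mult_neg_pos)
  have "\<kappa> * lo * a = p + \<bar>\<kappa>\<bar> * a\<^sup>2" "\<kappa> * hi * a = p - \<bar>\<kappa>\<bar> * a\<^sup>2"
    using \<kappa>a by (auto simp: lo_def hi_def)
  then have "W hi a \<le> p" "p \<le> W lo a"
    using bound[of lo] bound[of hi] by linarith+
  moreover have "lo \<le> hi"
    unfolding lo_def hi_def using \<kappa>a by (intro divide_right_mono_neg) auto
  ultimately obtain x where "W x a = p"
    using IVT2'[of "\<lambda>x. W x a" hi p lo] cont by auto
  then show ?thesis using UW(1,3) by blast
qed


section \<open>From the system to the surface\<close>

lemma band_patch_Ck2:
  assumes u: "\<And>r. (u has_real_derivative u1 r) (at r)"
    and u1: "\<And>r. (u1 has_real_derivative u2 r) (at r)"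
    and u2: "continuous_on UNIV u2"
  shows "Ck_patch 2 (band_patch u) D"
proof -
  have X1: "((\<lambda>s. band_patch u (s, t)) has_vector_derivative vector [1, 0, u1 s]) (at s)"
    and X2: "((\<lambda>t. band_patch u (s, t)) has_vector_derivative vector [0, 1, 0]) (at t)" for s t
    unfolding band_patch_def prod.case
    by (auto intro!: vector3_has_vector_derivative u)
  have d1: "d1 (band_patch u) = (\<lambda>(s, t). vector [1, 0, u1 s])"
    and d2: "d2 (band_patch u) = (\<lambda>_. vector [0, 1, 0])"
    using vector_derivative_at[OF X1] vector_derivative_at[OF X2]
    by (auto simp: d1_def d2_def fun_eq_iff)
  have Y: "((\<lambda>s. vector [1, 0, u1 s] :: real^3) has_vector_derivative vector [0, 0, u2 s]) (at s)" for s
    by (auto intro!: vector3_has_vector_derivative u1)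
  have d11: "d1 (\<lambda>(s, t). vector [1, 0, u1 s]) = (\<lambda>(s, t). vector [0, 0, u2 s])"
    using vector_derivative_at[OF Y] by (auto simp: d1_def fun_eq_iff)
  have d12: "d2 (\<lambda>(s, t). vector [1, 0, u1 s]) = (\<lambda>_. 0)"
    by (auto simp: d2_def fun_eq_iff)
  have d2c: "d1 (\<lambda>_. v) = (\<lambda>_. 0)" "d2 (\<lambda>_. v) = (\<lambda>_. 0)" for v
    by (auto simp: d1_def d2_def fun_eq_iff)
  have "continuous_on D (\<lambda>p. vector [0, 0, u2 (fst p)] :: real^3)"
  proof -
    have eq: "vector [0, 0, x] = x *\<^sub>R (axis 3 1 :: real^3)" for x :: real
      by (simp add: vec_eq_iff forall_3 axis_def)
    show ?thesis
      unfolding eq by (intro continuous_intros continuous_on_compose2[OF u2]) auto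
  qed
  then have cont: "continuous_on D (\<lambda>(s, t). vector [0, 0, u2 s] :: real^3)"
    by (simp add: case_prod_beta')
  show ?thesis
    unfolding numeral_2_eq_2 using cont
    by (auto simp: d1 d2 d11 d12 d2c intro: differentiableI_vector[OF X1] differentiableI_vector[OF X2]
        differentiableI_vector[OF Y])
qed

lemma band_patch_spacelike:
  assumes "(u has_real_derivative q) (at r)" "\<bar>q\<bar> < 1"
  shows "spacelike_at (band_patch u) (r, t)"
proof -
  have d1: "d1 (band_patch u) (r, t) = vector [1, 0, q]"
    unfolding d1_def band_patch_def prod.case
    by (intro vector_derivative_at vector3_has_vector_derivative assms) auto
  have d2: "d2 (band_patch u) (r, t) = vector [0, 1, 0]"
    unfolding d2_def band_patch_def prod.case
    by (intro vector_derivative_at vector3_has_vector_derivative) auto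
  have pos: "1 - q\<^sup>2 > 0" using assms(2) by (simp add: abs_square_less_1)
  have "x * x + y * y - x * q * (x * q) > 0" if "(x, y) \<noteq> (0, 0)" for x y :: real
  proof -
    have "x * x + y * y - x * q * (x * q) = x\<^sup>2 * (1 - q\<^sup>2) + y\<^sup>2"
      by (simp add: power2_eq_square algebra_simps)
    also have "\<dots> > 0"
      using that pos by (cases "x = 0") (auto intro: add_pos_nonneg)
    finally show ?thesis .
  qed
  then show ?thesis
    by (simp add: spacelike_at_def Let_def d1 d2 lorentz_def)
qed

lemma band_system_stationary_band:
  assumes "band_system \<kappa> u w"
  shows "stationary_band \<kappa> a u {vector [r, x2, u r] | r x2. -a < r \<and> r < a}"
proof -
  define u1 where "u1 r = velocity (w r)" for r
  define u2 where "u2 r = \<kappa> * u r / (1 + (w r)\<^sup>2) powr (3/2)" for r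
  have w': "(w has_real_derivative \<kappa> * u r) (at r)" for r
    using assms by (simp add: band_system_def)
  have u': "(u has_real_derivative u1 r) (at r)" for r
    using assms by (simp add: band_system_def u1_def)
  have u1': "(u1 has_real_derivative u2 r) (at r)" for r
    using DERIV_chain2[OF velocity_has_derivative w'] by (simp add: u1_def[abs_def] u2_def)
  have "continuous_on UNIV u" "continuous_on UNIV w"
    using u' w' by (meson DERIV_isCont continuous_at_imp_continuous_on)+
  moreover have "1 + (w r)\<^sup>2 \<noteq> 0" for r
    using one_plus_square_pos[of "w r"] by simp
  ultimately have "continuous_on UNIV u2"
    unfolding u2_def by (intro continuous_intros) auto
  with u' u1' have C2: "Ck_patch 2 (band_patch u) (strip a)"
    by (rule band_patch_Ck2)
  have less: "\<bar>u1 r\<bar> < 1" for r by (simp add: u1_def abs_velocity_less_1)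
  have "2 * mean_curvature (band_patch u) (r, t) = \<kappa> * band_patch u (r, t) $ 3" for r t
    unfolding mean_curvature_band[OF u' u1' less] using one_plus_square_pos[of "w r"]
    by (simp add: u1_def u2_def one_minus_velocity_square
        powr_divide band_patch_def)
  then show ?thesis
    using C2 band_patch_spacelike[OF u' less] by (auto simp: stationary_band_def stationary_patch_def)
qed

lemma band_system_contact_angle:
  assumes sys: "band_system \<kappa> u w" and "w 0 = 0" and wa: "w a = sinh \<beta>"
  shows "band_contact_angle a u \<beta>"
proof -
  have u': "(u has_real_derivative velocity (w r)) (at r)" for r
    using sys by (simp add: band_system_def)
  \<comment> \<open>Evenness of \<open>u\<close> yields the condition at \<open>-a\<close> from the one at \<open>a\<close>.\<close>
  have "u = (\<lambda>r. u (- r))" "w = (\<lambda>r. - w (- r))"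
    by (rule band_system_unique[OF sys band_system_reflect[OF sys]]; simp add: \<open>w 0 = 0\<close>)+
  then have sym: "u (- a) = u a" "w (- a) = - sinh \<beta>"
    using wa by (metis add.inverse_inverse)+
  have right: "(u has_real_derivative tanh \<beta>) (at a)"
    using u'[of a] by (simp add: wa velocity_sinh)
  have left: "(u has_real_derivative - tanh \<beta>) (at (- a))"
    using u'[of "- a"] by (simp add: sym velocity_uminus velocity_sinh)
  have tanh_less: "\<bar>tanh \<beta>\<bar> < 1"
    using abs_velocity_less_1[of "sinh \<beta>"] by (simp add: velocity_sinh)
  have "1 - (tanh \<beta>)\<^sup>2 = 1 / (cosh \<beta>)\<^sup>2"
    using one_minus_velocity_square[of "sinh \<beta>"] cosh_square_eq[of \<beta>]
    by (simp add: velocity_sinh add.commute)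
  then have "1 / sqrt (1 - (tanh \<beta>)\<^sup>2) = cosh \<beta>"
    by (simp add: real_sqrt_divide)
  moreover have "lorentz (unit_normal (band_patch u) (a, t)) e3 = - (1 / sqrt (1 - (tanh \<beta>)\<^sup>2))"
    "lorentz (unit_normal (band_patch u) (- a, t)) e3 = - (1 / sqrt (1 - (tanh \<beta>)\<^sup>2))" for t
    using unit_normal_band[OF right] unit_normal_band[OF left] tanh_less
    by (auto simp: lorentz_def e3_def)
  ultimately have "lorentz (unit_normal (band_patch u) (a, t)) e3 = - cosh \<beta>"
    "lorentz (unit_normal (band_patch u) (- a, t)) e3 = - cosh \<beta>" for t
    by simp_all
  then show ?thesis
    using left right sym
    by (auto simp: band_contact_angle_def band_patch_def DERIV_imp_deriv real_differentiable_def)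
qed

theorem theorem6p5:
  fixes a \<kappa> \<beta> :: real
  assumes "a > 0" and "\<kappa> < 0"
  shows "\<exists>u0 u S. is_band_solution \<kappa> u0 u \<and> stationary_band \<kappa> a u S \<and> band_contact_angle a u \<beta>"
proof -
  obtain u w where sys: "band_system \<kappa> u w" "w 0 = 0" "w a = sinh \<beta>"
    using band_system_attains_momentum[OF assms(2,1)] by blast
  show ?thesis
    using is_band_solutionI[OF sys(1) refl sys(2)] band_system_stationary_band[OF sys(1), of a]
      band_system_contact_angle[OF sys]
    by (intro exI conjI)
qed

end
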